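(* Let $Q$ be a loop that is semi-universally flexible and has the inverse property. Then $Q$ is diassociative.
   Context: A loop $(Q,\cdot,\backslash,/,1)$ is a set $Q$ with binary operations $\cdot,\backslash,/$ and an element $1$ such that $x\backslash(x\cdot y)=y=(y\cdot x)/x$, $x\cdot(x\backslash y)=y=(y/x)\cdot x$ and $1\cdot x=x=x\cdot 1$ for all $x,y\in Q$; equivalently, $1$ is a two-sided identity and all left and right multiplication maps are bijections. For $a,b\in Q$, the (principal) loop isotope of $Q$ determined by $a,b$ is the loop on the set $Q$ with multiplication $x\cdot_{a,b}y=(x/a)\cdot(b\backslash y)$. Right loop isotopes are those with $a=1$ and left loop isotopes are those with $b=1$. A loop is flexible if $x\cdot(y\cdot x)=(x\cdot y)\cdot x$ for all $x,y$. A loop is semi-universally flexible (SUF) if all of its left loop isotopes and all of its right loop isotopes are flexible. Explicitly, this means that for all $x,y,u,v\in Q$: $x\cdot(v\backslash(y\cdot(v\backslash x)))=(x\cdot(v\backslash y))\cdot(v\backslash x)$ and $(x/u)\cdot((y/u)\cdot x)=(((x/u)\cdot y)/u)\cdot x$. A loop has the inverse property (IP) if $1/x=x\backslash 1$ for all $x$ (the common value being denoted $x^{-1}$) and $x^{-1}\cdot(x\cdot y)=y=(y\cdot x)\cdot x^{-1}$ for all $x,y$. A loop is diassociative if for any two of its elements the subloop they generate is a group (i.e. is associative). *)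

theory Defs
  imports "HOL-Algebra.Group"
begin

record 'a loop = "'a monoid" +
  ldiv :: "['a, 'a] \<Rightarrow> 'a"  (infixl "\<setminus>\<index>" 70)
  rdiv :: "['a, 'a] \<Rightarrow> 'a"  (infixl "\<oslash>\<index>" 70)

text \<open>
  \<open>x \<setminus> y\<close> is the left quotient, i.e. the solution \<open>z\<close> of \<open>x \<otimes> z = y\<close>, and \<open>y \<oslash> x\<close> is the right
  quotient, i.e. the solution \<open>z\<close> of \<open>z \<otimes> x = y\<close>.
\<close>

locale loop =
  fixes Q (structure)
  assumes mult_closed [simp, intro]: "\<lbrakk>x \<in> carrier Q; y \<in> carrier Q\<rbrakk> \<Longrightarrow> x \<otimes> y \<in> carrier Q"
    and ldiv_closed [simp, intro]: "\<lbrakk>x \<in> carrier Q; y \<in> carrier Q\<rbrakk> \<Longrightarrow> x \<setminus> y \<in> carrier Q"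
    and rdiv_closed [simp, intro]: "\<lbrakk>x \<in> carrier Q; y \<in> carrier Q\<rbrakk> \<Longrightarrow> x \<oslash> y \<in> carrier Q"
    and one_closed [simp, intro]: "\<one> \<in> carrier Q"
    and ldiv_mult [simp]: "\<lbrakk>x \<in> carrier Q; y \<in> carrier Q\<rbrakk> \<Longrightarrow> x \<setminus> (x \<otimes> y) = y"
    and mult_rdiv [simp]: "\<lbrakk>x \<in> carrier Q; y \<in> carrier Q\<rbrakk> \<Longrightarrow> (y \<otimes> x) \<oslash> x = y"
    and mult_ldiv [simp]: "\<lbrakk>x \<in> carrier Q; y \<in> carrier Q\<rbrakk> \<Longrightarrow> x \<otimes> (x \<setminus> y) = y"
    and rdiv_mult [simp]: "\<lbrakk>x \<in> carrier Q; y \<in> carrier Q\<rbrakk> \<Longrightarrow> (y \<oslash> x) \<otimes> x = y"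
    and one_mult [simp]: "x \<in> carrier Q \<Longrightarrow> \<one> \<otimes> x = x"
    and mult_one [simp]: "x \<in> carrier Q \<Longrightarrow> x \<otimes> \<one> = x"

text \<open>
  The isotope determined by \<open>a, b\<close>. Its multiplication forces the identity \<open>b \<otimes> a\<close> and the two
  divisions given here (see \<open>loop_isotope\<close> below).
\<close>

definition isotope :: "('a, 'b) loop_scheme \<Rightarrow> 'a \<Rightarrow> 'a \<Rightarrow> 'a loop" where
  "isotope Q a b =
    \<lparr>carrier = carrier Q,
     mult = (\<lambda>x y. (x \<oslash>\<^bsub>Q\<^esub> a) \<otimes>\<^bsub>Q\<^esub> (b \<setminus>\<^bsub>Q\<^esub> y)),
     one = b \<otimes>\<^bsub>Q\<^esub> a,
     ldiv = (\<lambda>x y. b \<otimes>\<^bsub>Q\<^esub> ((x \<oslash>\<^bsub>Q\<^esub> a) \<setminus>\<^bsub>Q\<^esub> y)),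
     rdiv = (\<lambda>y x. (y \<oslash>\<^bsub>Q\<^esub> (b \<setminus>\<^bsub>Q\<^esub> x)) \<otimes>\<^bsub>Q\<^esub> a)\<rparr>"

lemma (in loop) loop_isotope:
  assumes "a \<in> carrier Q" "b \<in> carrier Q"
  shows "loop (isotope Q a b)"
  by unfold_locales (use assms in \<open>simp_all add: isotope_def\<close>)

definition flexible :: "('a, 'b) loop_scheme \<Rightarrow> bool" where
  "flexible Q \<longleftrightarrow>
    (\<forall>x \<in> carrier Q. \<forall>y \<in> carrier Q. x \<otimes>\<^bsub>Q\<^esub> (y \<otimes>\<^bsub>Q\<^esub> x) = (x \<otimes>\<^bsub>Q\<^esub> y) \<otimes>\<^bsub>Q\<^esub> x)"

definition semi_universally_flexible :: "('a, 'b) loop_scheme \<Rightarrow> bool" where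
  "semi_universally_flexible Q \<longleftrightarrow>
    (\<forall>a \<in> carrier Q. flexible (isotope Q a \<one>\<^bsub>Q\<^esub>)) \<and>
    (\<forall>b \<in> carrier Q. flexible (isotope Q \<one>\<^bsub>Q\<^esub> b))"

text \<open>
  The common value \<open>\<one> \<oslash> x = x \<setminus> \<one>\<close> is written out as \<open>x \<setminus> \<one>\<close>; the library's \<open>inv\<close> is not used, since
  its definition by unique choice is meant for monoids.
\<close>

definition inverse_property :: "('a, 'b) loop_scheme \<Rightarrow> bool" where
  "inverse_property Q \<longleftrightarrow>
    (\<forall>x \<in> carrier Q. \<one>\<^bsub>Q\<^esub> \<oslash>\<^bsub>Q\<^esub> x = x \<setminus>\<^bsub>Q\<^esub> \<one>\<^bsub>Q\<^esub>) \<and>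
    (\<forall>x \<in> carrier Q. \<forall>y \<in> carrier Q.
      (x \<setminus>\<^bsub>Q\<^esub> \<one>\<^bsub>Q\<^esub>) \<otimes>\<^bsub>Q\<^esub> (x \<otimes>\<^bsub>Q\<^esub> y) = y \<and> (y \<otimes>\<^bsub>Q\<^esub> x) \<otimes>\<^bsub>Q\<^esub> (x \<setminus>\<^bsub>Q\<^esub> \<one>\<^bsub>Q\<^esub>) = y)"

inductive_set subloop_generated :: "('a, 'b) loop_scheme \<Rightarrow> 'a set \<Rightarrow> 'a set"
  for Q and S where
  incl: "x \<in> S \<Longrightarrow> x \<in> subloop_generated Q S"
| one: "\<one>\<^bsub>Q\<^esub> \<in> subloop_generated Q S"
| mult: "\<lbrakk>x \<in> subloop_generated Q S; y \<in> subloop_generated Q S\<rbrakk>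
    \<Longrightarrow> x \<otimes>\<^bsub>Q\<^esub> y \<in> subloop_generated Q S"
| ldiv: "\<lbrakk>x \<in> subloop_generated Q S; y \<in> subloop_generated Q S\<rbrakk>
    \<Longrightarrow> x \<setminus>\<^bsub>Q\<^esub> y \<in> subloop_generated Q S"
| rdiv: "\<lbrakk>x \<in> subloop_generated Q S; y \<in> subloop_generated Q S\<rbrakk>
    \<Longrightarrow> x \<oslash>\<^bsub>Q\<^esub> y \<in> subloop_generated Q S"

lemma (in loop) subloop_generated_closed:
  assumes "S \<subseteq> carrier Q" "x \<in> subloop_generated Q S"
  shows "x \<in> carrier Q"
  using assms(2) by induction (use assms(1) in auto)

lemma (in loop) loop_subloop_generated:
  assumes "S \<subseteq> carrier Q"
  shows "loop (Q\<lparr>carrier := subloop_generated Q S\<rparr>)"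
  by unfold_locales
    (simp_all add: subloop_generated.intros subloop_generated_closed [OF assms])

definition diassociative :: "('a, 'b) loop_scheme \<Rightarrow> bool" where
  "diassociative Q \<longleftrightarrow>
    (\<forall>a \<in> carrier Q. \<forall>b \<in> carrier Q. group (Q\<lparr>carrier := subloop_generated Q {a, b}\<rparr>))"

end

theory Submission
  imports Defs
begin

text \<open>
  Call \<open>(x, y, z)\<close> an associating triple if \<open>(x \<otimes> y) \<otimes> z = x \<otimes> (y \<otimes> z)\<close>. In an inverse property
  loop, flexibility of the left isotopes is a symmetry of the set of associating triples: \<open>(x, y, z)\<close>
  associates iff \<open>(x \<otimes> z, y, z)\<close> does (\<open>associates_shift_left\<close>). Inversion gives the mirror image, that
  \<open>(x, y, z)\<close> associates iff \<open>(x, y, x \<otimes> z)\<close> does. So \<open>x\<close> and \<open>z\<close> may be changed by Nielsen moves while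
  \<open>y\<close> stays fixed, and the proof of diassociativity consists in moving triples of words in two
  generators to triples that are known to associate.

  Flexibility, both alternative laws and then power-alternativity come out of a few such moves. The
  basic tool for words is \<open>associates_power_right\<close>: if \<open>y\<close> and all powers of \<open>s\<close> associate behind
  \<open>x\<close>, then they do so behind \<open>x \<otimes> s\<^sup>k\<close>.

  Let \<open>a, b\<close> be the generators. An induction on the number of syllables (powers of \<open>a\<close> or \<open>b\<close>) of \<open>v\<close>
  shows that the triples \<open>(s\<^sup>i, v, t\<^sup>j)\<close> and \<open>(s\<^sup>i, t\<^sup>j, v)\<close> associate for \<open>s, t \<in> {a, b}\<close>
  (\<open>powers_associate\<close>). The first family says that multiplying syllables together from the left or
  from the right makes no difference, so that the products of syllables are closed under
  multiplication by powers on either side and under inverses. To allow arbitrary products in all three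
  entries, call \<open>x\<close> good (\<open>left_associator\<close>) if \<open>(x, v, t\<^sup>j)\<close> associates for all products \<open>v\<close> and all \<open>t\<close>.
  If all \<open>x \<otimes> t\<^sup>d\<close> are good, then so is \<open>u = (x \<otimes> t\<^sup>d) \<otimes> s\<^sup>k\<close> (\<open>left_associator_mult_power\<close>): triples
  \<open>(u, v, s\<^sup>j)\<close> are covered by the basic tool, and with \<open>z = t\<^sup>j \<otimes> s\<^sup>k\<close> and \<open>u = (x \<otimes> t\<^bsup>d-j\<^esup>) \<otimes> z\<close> one move
  takes \<open>(x \<otimes> t\<^bsup>d-j\<^esup>, v, z)\<close> to \<open>(u, v, z)\<close>, from which the factor \<open>s\<^sup>k\<close> of \<open>z\<close> can be cancelled. Hence all
  products are good; they are closed under multiplication and associate with each other, and they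
  contain the subloop generated by \<open>a\<close> and \<open>b\<close>.
\<close>

section \<open>Associating triples in a loop with the inverse property\<close>

locale suf_ip_loop = loop +
  assumes semi_flexible: "semi_universally_flexible Q"
    and inverse_prop: "inverse_property Q"
begin

definition inverse_of :: "'a \<Rightarrow> 'a"  ("_\<^sup>-" [999] 999)
  where "x\<^sup>- = x \<setminus> \<one>"

definition associates :: "'a \<Rightarrow> 'a \<Rightarrow> 'a \<Rightarrow> bool"
  where "associates x y z \<longleftrightarrow> (x \<otimes> y) \<otimes> z = x \<otimes> (y \<otimes> z)"

lemma inverse_closed [simp, intro]: "x \<in> carrier Q \<Longrightarrow> x\<^sup>- \<in> carrier Q"
  by (simp add: inverse_of_def)

lemma inverse_left_cancel [simp]:
  "\<lbrakk>x \<in> carrier Q; y \<in> carrier Q\<rbrakk> \<Longrightarrow> x\<^sup>- \<otimes> (x \<otimes> y) = y"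
  using inverse_prop by (auto simp: inverse_property_def inverse_of_def)

lemma inverse_right_cancel [simp]:
  "\<lbrakk>x \<in> carrier Q; y \<in> carrier Q\<rbrakk> \<Longrightarrow> (y \<otimes> x) \<otimes> x\<^sup>- = y"
  using inverse_prop by (auto simp: inverse_property_def inverse_of_def)

lemma right_inverse [simp]: "x \<in> carrier Q \<Longrightarrow> x \<otimes> x\<^sup>- = \<one>"
  by (simp add: inverse_of_def)

lemma left_inverse [simp]: "x \<in> carrier Q \<Longrightarrow> x\<^sup>- \<otimes> x = \<one>"
  using inverse_left_cancel[of x \<one>] by simp

lemma left_cancel:
  assumes "x \<in> carrier Q" "y \<in> carrier Q" "z \<in> carrier Q"
  shows "x \<otimes> y = x \<otimes> z \<longleftrightarrow> y = z"
  using assms ldiv_mult by metis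

lemma right_cancel:
  assumes "x \<in> carrier Q" "y \<in> carrier Q" "z \<in> carrier Q"
  shows "y \<otimes> x = z \<otimes> x \<longleftrightarrow> y = z"
  using assms mult_rdiv by metis

lemma inverse_unique:
  assumes "x \<in> carrier Q" "y \<in> carrier Q" "y \<otimes> x = \<one>"
  shows "x\<^sup>- = y"
  using assms inverse_right_cancel[of x y] by simp

lemma inverse_inverse [simp]: "x \<in> carrier Q \<Longrightarrow> x\<^sup>-\<^sup>- = x"
  using left_cancel[of "x\<^sup>-" "x\<^sup>-\<^sup>-" x] by simp

lemma inverse_one [simp]: "\<one>\<^sup>- = \<one>"
  by (metis inverse_closed one_closed one_mult right_inverse)

lemma mult_inverse_left_cancel [simp]:
  "\<lbrakk>x \<in> carrier Q; y \<in> carrier Q\<rbrakk> \<Longrightarrow> x \<otimes> (x\<^sup>- \<otimes> y) = y"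
  using inverse_left_cancel[of "x\<^sup>-" y] by simp

lemma mult_inverse_right_cancel [simp]:
  "\<lbrakk>x \<in> carrier Q; y \<in> carrier Q\<rbrakk> \<Longrightarrow> (y \<otimes> x\<^sup>-) \<otimes> x = y"
  using inverse_right_cancel[of "x\<^sup>-" y] by simp

lemma inverse_mult [simp]:
  assumes [simp]: "x \<in> carrier Q" "y \<in> carrier Q"
  shows "(x \<otimes> y)\<^sup>- = y\<^sup>- \<otimes> x\<^sup>-"
proof -
  have "(x \<otimes> y)\<^sup>- \<otimes> x = y\<^sup>-"
    using inverse_left_cancel[of "x \<otimes> y" "y\<^sup>-"] by simp
  then have "((x \<otimes> y)\<^sup>- \<otimes> x) \<otimes> x\<^sup>- = y\<^sup>- \<otimes> x\<^sup>-" by simp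
  then show ?thesis by simp
qed

lemma ldiv_eq: "\<lbrakk>x \<in> carrier Q; y \<in> carrier Q\<rbrakk> \<Longrightarrow> x \<setminus> y = x\<^sup>- \<otimes> y"
  using ldiv_mult[of x "x\<^sup>- \<otimes> y"] by simp

lemma rdiv_eq: "\<lbrakk>x \<in> carrier Q; y \<in> carrier Q\<rbrakk> \<Longrightarrow> y \<oslash> x = y \<otimes> x\<^sup>-"
  using mult_rdiv[of x "y \<otimes> x\<^sup>-"] by simp

lemma left_isotope_flexible:
  assumes [simp]: "x \<in> carrier Q" "y \<in> carrier Q" "v \<in> carrier Q"
  shows "x \<otimes> (v \<otimes> (y \<otimes> (v \<otimes> x))) = (x \<otimes> (v \<otimes> y)) \<otimes> (v \<otimes> x)"
proof -
  have "flexible (isotope Q \<one> (v\<^sup>-))"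
    using semi_flexible by (simp add: semi_universally_flexible_def)
  then have "(x \<oslash> \<one>) \<otimes> (v\<^sup>- \<setminus> ((y \<oslash> \<one>) \<otimes> (v\<^sup>- \<setminus> x)))
      = (((x \<oslash> \<one>) \<otimes> (v\<^sup>- \<setminus> y)) \<oslash> \<one>) \<otimes> (v\<^sup>- \<setminus> x)"
    by (simp add: flexible_def isotope_def)
  then show ?thesis by (simp add: ldiv_eq rdiv_eq)
qed

lemma associates_reverse:
  assumes [simp]: "x \<in> carrier Q" "y \<in> carrier Q" "z \<in> carrier Q"
  shows "associates (z\<^sup>-) (y\<^sup>-) (x\<^sup>-) \<longleftrightarrow> associates x y z"
proof -
  have "associates (z\<^sup>-) (y\<^sup>-) (x\<^sup>-) \<longleftrightarrow> ((x \<otimes> (y \<otimes> z))\<^sup>- = ((x \<otimes> y) \<otimes> z)\<^sup>-)"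
    by (simp add: associates_def)
  also have "\<dots> \<longleftrightarrow> associates x y z"
    unfolding associates_def
    by (metis assms inverse_inverse mult_closed)
  finally show ?thesis .
qed

text \<open>
  A triple may be pictured as the four points \<open>\<one>\<close>, \<open>x\<close>, \<open>x \<otimes> y\<close>, \<open>(x \<otimes> y) \<otimes> z\<close> with a path through them.
  In an inverse property loop the path may be reversed, and its first two points may be exchanged.
\<close>

lemma associates_swap:
  assumes [simp]: "x \<in> carrier Q" "y \<in> carrier Q" "z \<in> carrier Q"
  shows "associates (x\<^sup>-) (x \<otimes> y) z \<longleftrightarrow> associates x y z"
proof -
  have "associates (x\<^sup>-) (x \<otimes> y) z \<longleftrightarrow> x \<otimes> (y \<otimes> z) = x \<otimes> (x\<^sup>- \<otimes> ((x \<otimes> y) \<otimes> z))"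
    by (simp add: associates_def left_cancel del: mult_inverse_left_cancel)
  then show ?thesis by (auto simp: associates_def)
qed

text \<open>
  This is the flexibility of left isotopes in disguise: substitute \<open>x \<otimes> z\<close>, \<open>x\<^sup>-\<close>, \<open>x \<otimes> y\<close> for
  \<open>x\<close>, \<open>v\<close>, \<open>y\<close> in \<open>left_isotope_flexible\<close>, so that \<open>v \<otimes> x\<close> becomes \<open>z\<close>.
\<close>

lemma associates_shift_left:
  assumes [simp]: "x \<in> carrier Q" "y \<in> carrier Q" "z \<in> carrier Q"
  shows "associates (x \<otimes> z) y z \<longleftrightarrow> associates x y z"
proof -
  let ?t = "x \<otimes> z"
  have "(?t \<otimes> y) \<otimes> z = ?t \<otimes> (x\<^sup>- \<otimes> ((x \<otimes> y) \<otimes> z))"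
    using left_isotope_flexible[of ?t "x \<otimes> y" "x\<^sup>-"] by simp
  then have "associates ?t y z \<longleftrightarrow> x\<^sup>- \<otimes> ((x \<otimes> y) \<otimes> z) = y \<otimes> z"
    by (simp add: associates_def left_cancel)
  also have "\<dots> \<longleftrightarrow> (x \<otimes> y) \<otimes> z = x \<otimes> (y \<otimes> z)"
    by (metis assms inverse_left_cancel mult_closed mult_inverse_left_cancel)
  finally show ?thesis by (simp add: associates_def)
qed

lemma associates_shift_right:
  assumes [simp]: "x \<in> carrier Q" "y \<in> carrier Q" "z \<in> carrier Q"
  shows "associates x y (x \<otimes> z) \<longleftrightarrow> associates x y z"
proof -
  have "associates x y (x \<otimes> z) \<longleftrightarrow> associates (z\<^sup>- \<otimes> x\<^sup>-) (y\<^sup>-) (x\<^sup>-)"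
    using associates_reverse[of x y "x \<otimes> z"] by simp
  also have "\<dots> \<longleftrightarrow> associates x y z"
    by (simp add: associates_shift_left associates_reverse)
  finally show ?thesis .
qed

lemma associates_one [simp]:
  "\<lbrakk>x \<in> carrier Q; y \<in> carrier Q\<rbrakk> \<Longrightarrow> associates \<one> x y"
  "\<lbrakk>x \<in> carrier Q; y \<in> carrier Q\<rbrakk> \<Longrightarrow> associates x \<one> y"
  "\<lbrakk>x \<in> carrier Q; y \<in> carrier Q\<rbrakk> \<Longrightarrow> associates x y \<one>"
  by (simp_all add: associates_def)

section \<open>Alternative laws\<close>

lemma flexible_law:
  assumes [simp]: "x \<in> carrier Q" "y \<in> carrier Q"
  shows "associates x y x" "associates x y (x\<^sup>-)"
proof -
  show "associates x y x" using associates_shift_right[of x y \<one>] by simp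
  show "associates x y (x\<^sup>-)"
    using associates_shift_right[of x y "x\<^sup>-"] by simp
qed

lemma associates_cyclic_square:
  assumes [simp]: "x \<in> carrier Q" "v \<in> carrier Q"
  shows "associates x v (v \<otimes> x)"
  using left_isotope_flexible[of x \<one> v] by (simp add: associates_def)

text \<open>
  By a shift it suffices that \<open>(x, y, x\<^sup>- \<otimes> y)\<close> associates. Both bracketings of this product occur in
  instances of \<open>associates_cyclic_square\<close>, and flexibility identifies the remaining sides.
\<close>

lemma right_alternative:
  assumes [simp]: "x \<in> carrier Q" "y \<in> carrier Q"
  shows "associates x y y"
proof -
  have "((x \<otimes> y) \<otimes> x\<^sup>-) \<otimes> y = (x \<otimes> y) \<otimes> (x\<^sup>- \<otimes> y)"
    using associates_cyclic_square[of "x \<otimes> y" "x\<^sup>-"] by (simp add: associates_def)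
  moreover have "(x \<otimes> (y \<otimes> x\<^sup>-)) \<otimes> y = x \<otimes> ((y \<otimes> x\<^sup>-) \<otimes> y)"
    using associates_cyclic_square[of x "y \<otimes> x\<^sup>-"] by (simp add: associates_def)
  ultimately have "associates x y (x\<^sup>- \<otimes> y)"
    using flexible_law(2)[of x y] flexible_law(1)[of y "x\<^sup>-"] by (simp add: associates_def)
  then show ?thesis
    using associates_shift_right[of x y "x\<^sup>- \<otimes> y"] by simp
qed

lemma left_alternative:
  assumes [simp]: "x \<in> carrier Q" "y \<in> carrier Q"
  shows "associates x x y"
  using right_alternative[of "y\<^sup>-" "x\<^sup>-"] associates_reverse[of x x y] by simp

text \<open>The base of the induction that produces the odd powers below.\<close>

lemma associates_conjugate_square:
  assumes [simp]: "x \<in> carrier Q" "y \<in> carrier Q"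
  shows "associates x y (y \<otimes> x\<^sup>-)"
proof -
  have "associates (x\<^sup>-) (x \<otimes> y) ((x \<otimes> y) \<otimes> x\<^sup>-)"
    by (simp add: associates_cyclic_square)
  then have "associates x y ((x \<otimes> y) \<otimes> x\<^sup>-)"
    by (simp add: associates_swap)
  moreover have "(x \<otimes> y) \<otimes> x\<^sup>- = x \<otimes> (y \<otimes> x\<^sup>-)"
    using flexible_law(2)[of x y] by (simp add: associates_def)
  ultimately show ?thesis by (simp add: associates_shift_right)
qed

section \<open>Power-alternativity\<close>

text \<open>
  Powers are iterated right translations of \<open>\<one>\<close>. That they act by iterated translation on every
  element, from either side, is proved below.
\<close>

definition nat_power :: "'a \<Rightarrow> nat \<Rightarrow> 'a"
  where "nat_power x n = ((\<lambda>z. z \<otimes> x) ^^ n) \<one>"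

definition int_power :: "'a \<Rightarrow> int \<Rightarrow> 'a"  (infixr "\<up>" 75)
  where "x \<up> i = (if 0 \<le> i then nat_power x (nat i) else nat_power (x\<^sup>-) (nat (- i)))"

lemma funpow_mult_closed [simp]:
  assumes "x \<in> carrier Q" "z \<in> carrier Q"
  shows "((\<lambda>z. z \<otimes> x) ^^ n) z \<in> carrier Q" "((\<otimes>) x ^^ n) z \<in> carrier Q"
  by (induction n) (use assms in auto)

lemma nat_power_closed [simp, intro]: "x \<in> carrier Q \<Longrightarrow> nat_power x n \<in> carrier Q"
  by (simp add: nat_power_def)

lemma funpow_mult_inverse:
  assumes [simp]: "x \<in> carrier Q" "z \<in> carrier Q"
  shows "((\<otimes>) (x\<^sup>-) ^^ n) (((\<otimes>) x ^^ n) z) = z"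
proof (induction n)
  case (Suc n)
  have "((\<otimes>) (x\<^sup>-) ^^ Suc n) (((\<otimes>) x ^^ Suc n) z)
      = ((\<otimes>) (x\<^sup>-) ^^ n) (x\<^sup>- \<otimes> (x \<otimes> ((\<otimes>) x ^^ n) z))"
    by (subst funpow_Suc_right) simp
  then show ?case using Suc by simp
qed simp

text \<open>
  Write \<open>w = x\<^sup>k\<close> and \<open>Y = z \<otimes> x\<^bsup>k+1\<^esup>\<close>, so that \<open>z \<otimes> w = Y \<otimes> x\<^sup>-\<close>. Starting from
  \<open>associates_conjugate_square\<close>, the triple \<open>(x, x\<^sup>i Y, Y \<otimes> x\<^sup>-)\<close> associates for every \<open>i\<close>, because its
  last entry can be shifted by \<open>x\<close> until it becomes \<open>x\<^sup>i Y \<otimes> x\<^sup>-\<close>. Hence \<open>k\<close> left translations by \<open>x\<close>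
  can be pulled into the product \<open>Y \<otimes> (z \<otimes> w)\<close>, that is, \<open>(w, Y, z \<otimes> w)\<close> associates. Flexibility of left
  isotopes turns this into the associativity of \<open>(z, x\<^bsup>k+1\<^esup>, z \<otimes> w)\<close>.
\<close>

lemma associates_consecutive_powers:
  assumes x: "x \<in> carrier Q" and z: "z \<in> carrier Q"
    and left: "\<And>u. u \<in> carrier Q \<Longrightarrow> nat_power x k \<otimes> u = ((\<otimes>) x ^^ k) u"
    and right: "\<And>u. u \<in> carrier Q \<Longrightarrow> u \<otimes> nat_power x k = ((\<lambda>u. u \<otimes> x) ^^ k) u"
    and right_Suc: "\<And>u. u \<in> carrier Q \<Longrightarrow> u \<otimes> nat_power x (Suc k) = ((\<lambda>u. u \<otimes> x) ^^ Suc k) u"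
  shows "associates z (nat_power x (Suc k)) (nat_power x k)"
proof -
  note [simp] = x z
  let ?w = "nat_power x k"
  define Y where "Y = z \<otimes> nat_power x (Suc k)"
  have [simp]: "Y \<in> carrier Q" by (simp add: Y_def)
  have Yw: "Y \<otimes> x\<^sup>- = z \<otimes> ?w"
    by (simp add: Y_def right right_Suc)
  have comm: "((\<otimes>) x ^^ i) Y \<otimes> x\<^sup>- = ((\<otimes>) x ^^ i) (Y \<otimes> x\<^sup>-)" for i
    by (induction i) (use flexible_law(2) in \<open>simp_all add: associates_def\<close>)
  have step: "associates x (((\<otimes>) x ^^ i) Y) (Y \<otimes> x\<^sup>-)" for i
  proof -
    have "associates x (((\<otimes>) x ^^ i) Y) (((\<otimes>) x ^^ j) (Y \<otimes> x\<^sup>-))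
        \<longleftrightarrow> associates x (((\<otimes>) x ^^ i) Y) (Y \<otimes> x\<^sup>-)" for j
      by (induction j) (simp_all add: associates_shift_right)
    from this[of i] show ?thesis
      using associates_conjugate_square[of x "((\<otimes>) x ^^ i) Y"] by (simp add: comm)
  qed
  have "((\<otimes>) x ^^ i) (Y \<otimes> (Y \<otimes> x\<^sup>-)) = (((\<otimes>) x ^^ i) Y) \<otimes> (Y \<otimes> x\<^sup>-)" for i
    by (induction i) (use step in \<open>simp_all add: associates_def\<close>)
  then have "?w \<otimes> (Y \<otimes> (z \<otimes> ?w)) = (?w \<otimes> Y) \<otimes> (z \<otimes> ?w)"
    by (simp add: left flip: Yw)
  also have "\<dots> = ?w \<otimes> (z \<otimes> (nat_power x (Suc k) \<otimes> (z \<otimes> ?w)))"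
    using left_isotope_flexible[of ?w "nat_power x (Suc k)" z] by (simp add: Y_def)
  finally have "associates z (nat_power x (Suc k)) (z \<otimes> ?w)"
    by (simp add: left_cancel associates_def Y_def)
  then show ?thesis by (simp add: associates_shift_right)
qed

text \<open>
  Even powers are squares, so the alternative laws double the exponent; for an odd exponent
  \<open>2 k + 1\<close> the splitting into \<open>k + 1\<close> and \<open>k\<close> comes from \<open>associates_consecutive_powers\<close>.
\<close>

lemma nat_power_mult:
  assumes "x \<in> carrier Q" "z \<in> carrier Q"
  shows "z \<otimes> nat_power x n = ((\<lambda>u. u \<otimes> x) ^^ n) z \<and> nat_power x n \<otimes> z = ((\<otimes>) x ^^ n) z"
  using assms
proof (induction n arbitrary: x z rule: less_induct)
  case (less n)
  note [simp] = less.prems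
  have right: "z \<otimes> nat_power x i = ((\<lambda>u. u \<otimes> x) ^^ i) z"
    and left: "nat_power x i \<otimes> z = ((\<otimes>) x ^^ i) z"
    if "i < n" "x \<in> carrier Q" "z \<in> carrier Q" for i x z
    using less.IH that by blast+
  have inv_power: "(nat_power x i)\<^sup>- = nat_power (x\<^sup>-) i" if "i < n" "x \<in> carrier Q" for i x
  proof -
    have "nat_power (x\<^sup>-) i \<otimes> (nat_power x i \<otimes> \<one>) = \<one>"
      using that by (simp add: left funpow_mult_inverse del: mult_one)
    then show ?thesis using that by (simp add: inverse_unique)
  qed
  have add: "nat_power x (i + j) = nat_power x j \<otimes> nat_power x i" if "i < n" for i j
    using that by (simp add: right) (simp add: nat_power_def funpow_add)
  have "n = 0 \<or> n = 1 \<or> (\<exists>k>0. n = k + k) \<or> (\<exists>k>0. n = Suc k + k)"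
    by presburger
  then consider "n = 0" | "n = 1" | k where "0 < k" "n = k + k" | k where "0 < k" "n = Suc k + k"
    by blast
  then show ?case
  proof cases
    case 3
    have "z \<otimes> nat_power x n = (z \<otimes> nat_power x k) \<otimes> nat_power x k"
      using right_alternative[of z "nat_power x k"] 3 by (simp add: add associates_def)
    moreover have "nat_power x n \<otimes> z = nat_power x k \<otimes> (nat_power x k \<otimes> z)"
      using left_alternative[of "nat_power x k" z] 3 by (simp add: add associates_def)
    ultimately show ?thesis
      using 3 by (simp add: left right funpow_add)
  next
    case 4
    have k: "k < n" "Suc k < n" using 4 by auto
    have assoc: "associates z (nat_power x (Suc k)) (nat_power x k)"
      if "x \<in> carrier Q" "z \<in> carrier Q" for x z
      using that by (intro associates_consecutive_powers left right k)
    have "associates (z\<^sup>-) (nat_power (x\<^sup>-) (Suc k)) (nat_power (x\<^sup>-) k)"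
      by (intro assoc) simp_all
    then have "associates (nat_power x k) (nat_power x (Suc k)) z"
      using associates_reverse[of "nat_power x k" "nat_power x (Suc k)" z]
      by (simp add: inv_power k)
    then have "nat_power x n \<otimes> z = nat_power x k \<otimes> (nat_power x (Suc k) \<otimes> z)"
      using add[OF k(2), of k] unfolding 4 by (simp only: associates_def)
    also have "\<dots> = ((\<otimes>) x ^^ n) z"
      by (simp only: left[OF k(1)] left[OF k(2)] less.prems mult_closed nat_power_closed funpow_mult_closed
          4(2) add.commute[of "Suc k" k] funpow_add comp_apply)
    finally have "nat_power x n \<otimes> z = ((\<otimes>) x ^^ n) z" .
    moreover have "z \<otimes> nat_power x n = (z \<otimes> nat_power x (Suc k)) \<otimes> nat_power x k"
      using add[OF k(1), of "Suc k"] assoc[OF less.prems] 4(2) add.commute[of "Suc k" k]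
      by (simp only: associates_def)
    moreover have "\<dots> = ((\<lambda>u. u \<otimes> x) ^^ n) z"
      by (simp only: right[OF k(1)] right[OF k(2)] less.prems mult_closed nat_power_closed funpow_mult_closed
          4(2) add.commute[of "Suc k" k] funpow_add comp_apply)
    ultimately show ?thesis by simp
  qed (simp_all add: nat_power_def)
qed

lemma inverse_nat_power:
  assumes "x \<in> carrier Q"
  shows "(nat_power x n)\<^sup>- = nat_power (x\<^sup>-) n"
proof -
  have "nat_power (x\<^sup>-) n \<otimes> (nat_power x n \<otimes> \<one>) = \<one>"
    using assms by (simp add: nat_power_mult funpow_mult_inverse del: mult_one)
  then show ?thesis using assms by (simp add: inverse_unique)
qed

lemma int_power_closed [simp, intro]: "x \<in> carrier Q \<Longrightarrow> x \<up> i \<in> carrier Q"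
  by (simp add: int_power_def)

lemma int_power_zero [simp]: "x \<up> 0 = \<one>"
  by (simp add: int_power_def nat_power_def)

lemma int_power_one [simp]: "x \<in> carrier Q \<Longrightarrow> x \<up> 1 = x"
  by (simp add: int_power_def nat_power_def)

lemma inverse_int_power [simp]: "x \<in> carrier Q \<Longrightarrow> (x \<up> i)\<^sup>- = x \<up> (- i)"
  using nat_power_def[of x 0] nat_power_def[of "x\<^sup>-" 0]
  by (auto simp: int_power_def inverse_nat_power)

lemma int_power_Suc:
  assumes [simp]: "x \<in> carrier Q" "z \<in> carrier Q"
  shows "x \<up> (i + 1) \<otimes> z = x \<otimes> (x \<up> i \<otimes> z)"
proof (cases "0 \<le> i")
  case True
  then have "nat (i + 1) = Suc (nat i)" by simp
  then show ?thesis using True by (simp add: int_power_def nat_power_mult)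
next
  case False
  then obtain n where n: "i = - int (Suc n)"
    by (metis negD not_le)
  then have "x \<up> i = nat_power (x\<^sup>-) (Suc n)" "x \<up> (i + 1) = nat_power (x\<^sup>-) n"
    by (auto simp: int_power_def nat_power_def nat_add_distrib)
  then show ?thesis by (simp add: nat_power_mult)
qed

lemma int_power_add_left [simp]:
  assumes [simp]: "x \<in> carrier Q" "z \<in> carrier Q"
  shows "x \<up> i \<otimes> (x \<up> j \<otimes> z) = x \<up> (i + j) \<otimes> z"
proof (induction i rule: int_induct[where k = 0])
  case (step1 i)
  then show ?case
    using int_power_Suc[of x "x \<up> j \<otimes> z" i] int_power_Suc[of x z "i + j"] by (simp add: ac_simps)
next
  case (step2 i)
  then have "x \<otimes> (x \<up> (i - 1) \<otimes> (x \<up> j \<otimes> z)) = x \<otimes> (x \<up> (i - 1 + j) \<otimes> z)"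
    using int_power_Suc[of x "x \<up> j \<otimes> z" "i - 1"] int_power_Suc[of x z "i - 1 + j"]
    by (simp add: algebra_simps)
  then show ?case by (simp add: left_cancel)
qed simp

lemma int_power_add [simp]: "x \<in> carrier Q \<Longrightarrow> x \<up> i \<otimes> x \<up> j = x \<up> (i + j)"
  using int_power_add_left[of x \<one> i j] by simp

lemma int_power_add_right [simp]:
  assumes [simp]: "x \<in> carrier Q" "z \<in> carrier Q"
  shows "(z \<otimes> x \<up> i) \<otimes> x \<up> j = z \<otimes> x \<up> (i + j)"
proof -
  have "((z \<otimes> x \<up> i) \<otimes> x \<up> j)\<^sup>- = (z \<otimes> x \<up> (i + j))\<^sup>-"
    by (simp add: algebra_simps)
  then show ?thesis by (metis assms int_power_closed inverse_inverse mult_closed)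
qed


section \<open>Absorbing powers into associating triples\<close>

text \<open>
  The shift \<open>x \<mapsto> x \<otimes> s\<close> is only available when the last entry is \<open>s\<close> itself. So the powers of \<open>s\<close> in
  the last entry are first moved into the middle one by one, which leaves triples
  \<open>(x, y \<otimes> s\<^sup>c, s)\<close>; after the shift they are collected again.
\<close>

lemma associates_power_right:
  assumes [simp]: "x \<in> carrier Q" "y \<in> carrier Q" "s \<in> carrier Q"
    and assoc: "\<And>c. associates x y (s \<up> c)"
  shows "associates (x \<otimes> s \<up> k) y (s \<up> c)"
proof -
  have shift: "associates (x \<otimes> s \<up> k) w s \<longleftrightarrow> associates x w s" if [simp]: "w \<in> carrier Q" for k w
  proof (induction k rule: int_induct[where k = 0])
    case (step1 i)
    then show ?case
      using associates_shift_left[of "x \<otimes> s \<up> i" w s] int_power_add_right[of s x i 1] by simp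
  next
    case (step2 i)
    then show ?case
      using associates_shift_left[of "x \<otimes> s \<up> (i - 1)" w s] int_power_add_right[of s x "i - 1" 1]
      by simp
  qed simp
  have "associates x (y \<otimes> s \<up> c) s" for c
    using assoc[of c] assoc[of "c + 1"] int_power_add_right[of s "x \<otimes> y" c 1]
      int_power_add_right[of s y c 1]
    by (simp add: associates_def)
  then have letter: "associates (x \<otimes> s \<up> k) (y \<otimes> s \<up> c) s" for c
    by (simp add: shift)
  show ?thesis
  proof (induction c rule: int_induct[where k = 0])
    case (step1 i)
    then show ?case
      using letter[of i] int_power_add_right[of s "(x \<otimes> s \<up> k) \<otimes> y" i 1]
        int_power_add_right[of s y i 1]
      by (simp add: associates_def)
  next
    case (step2 i)
    have "((x \<otimes> s \<up> k) \<otimes> (y \<otimes> s \<up> (i - 1))) \<otimes> s = (((x \<otimes> s \<up> k) \<otimes> y) \<otimes> s \<up> (i - 1)) \<otimes> s"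
      using step2 letter[of "i - 1"] int_power_add_right[of s "(x \<otimes> s \<up> k) \<otimes> y" "i - 1" 1]
        int_power_add_right[of s y "i - 1" 1]
      by (simp add: associates_def)
    then show ?case by (simp add: right_cancel associates_def)
  qed simp
qed

lemma associates_power_left:
  assumes [simp]: "s \<in> carrier Q" "y \<in> carrier Q" "z \<in> carrier Q"
    and assoc: "\<And>c. associates (s \<up> c) y z"
  shows "associates (s \<up> c) y (s \<up> k \<otimes> z)"
proof -
  have "associates (z\<^sup>-) (y\<^sup>-) (s \<up> c)" for c
    using assoc[of "- c"] associates_reverse[of "s \<up> (- c)" y z] by simp
  then have "associates (z\<^sup>- \<otimes> s \<up> (- k)) (y\<^sup>-) (s \<up> (- c))"
    by (intro associates_power_right) auto
  then show ?thesis
    using associates_reverse[of "s \<up> c" y "s \<up> k \<otimes> z"] by simp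
qed

lemma associates_powers [simp]:
  assumes [simp]: "s \<in> carrier Q" "y \<in> carrier Q"
  shows "associates (s \<up> i) y (s \<up> j)" "associates (s \<up> i) (s \<up> j) y" "associates y (s \<up> i) (s \<up> j)"
proof -
  show "associates (s \<up> i) y (s \<up> j)"
    using associates_power_right[of \<one> y s i j] by simp
qed (simp_all add: associates_def)

lemma associates_pentagon:
  assumes "x \<in> carrier Q" "y \<in> carrier Q" "z \<in> carrier Q" "w \<in> carrier Q"
    and "associates x y z" "associates y z w" "associates (x \<otimes> y) z w" "associates x y (z \<otimes> w)"
  shows "associates x (y \<otimes> z) w"
  using assms by (simp add: associates_def)

section \<open>Products of powers of two elements\<close>

text \<open>
  Products of \<open>n\<close> syllables, bracketed to the right. The exponent of a syllable may be zero and
  neighbouring syllables may be powers of the same element, so no normal form is imposed.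
\<close>

primrec products :: "'a set \<Rightarrow> nat \<Rightarrow> 'a set" where
  "products S 0 = {\<one>}"
| "products S (Suc n) = {s \<up> i \<otimes> v |s i v. s \<in> S \<and> v \<in> products S n}"

lemma products_closed:
  assumes "S \<subseteq> carrier Q"
  shows "v \<in> products S n \<Longrightarrow> v \<in> carrier Q"
  by (induction n arbitrary: v) (use assms in auto)

lemma products_SucI: "\<lbrakk>s \<in> S; v \<in> products S n\<rbrakk> \<Longrightarrow> s \<up> i \<otimes> v \<in> products S (Suc n)"
  by auto

lemma products_SucE:
  assumes "v \<in> products S (Suc n)"
  obtains s i w where "v = s \<up> i \<otimes> w" "s \<in> S" "w \<in> products S n"
  using assms by auto

declare products.simps(2) [simp del]

definition outer_powers_associate :: "'a set \<Rightarrow> nat \<Rightarrow> bool" where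
  "outer_powers_associate S n \<longleftrightarrow>
    (\<forall>s\<in>S. \<forall>t\<in>S. \<forall>v\<in>products S n. \<forall>i j. associates (s \<up> i) v (t \<up> j))"

definition initial_powers_associate :: "'a set \<Rightarrow> nat \<Rightarrow> bool" where
  "initial_powers_associate S n \<longleftrightarrow>
    (\<forall>s\<in>S. \<forall>t\<in>S. \<forall>v\<in>products S n. \<forall>i j. associates (s \<up> i) (t \<up> j) v)"

text \<open>
  As long as outer powers associate with shorter products, products that are bracketed to the right
  can be rewritten as products that are bracketed to the left; this and the next lemma use it to add
  or split off a syllable at the right end.
\<close>

lemma products_mult_power:
  assumes S: "S \<subseteq> carrier Q" and outer: "\<And>j. j < n \<Longrightarrow> outer_powers_associate S j"
    and t: "t \<in> S" and v: "v \<in> products S n"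
  shows "v \<otimes> t \<up> j \<in> products S (Suc n)"
  using outer v
proof (induction n arbitrary: v)
  case 0
  moreover have "t \<up> j \<otimes> \<one> \<in> products S (Suc 0)" by (rule products_SucI[OF t]) simp
  moreover have "t \<in> carrier Q" using S t by blast
  ultimately show ?case by simp
next
  case (Suc n)
  then obtain s i w where w: "v = s \<up> i \<otimes> w" "s \<in> S" "w \<in> products S n"
    by (metis products_SucE)
  have "associates (s \<up> i) w (t \<up> j)"
    using Suc.prems(1)[of n] w t by (auto simp: outer_powers_associate_def)
  then have "v \<otimes> t \<up> j = s \<up> i \<otimes> (w \<otimes> t \<up> j)" by (simp add: w associates_def)
  moreover have "w \<otimes> t \<up> j \<in> products S (Suc n)" using Suc w by simp
  ultimately show ?case using products_SucI w(2) by metis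
qed

lemma products_last_power:
  assumes S: "S \<subseteq> carrier Q" and outer: "\<And>j. j < n \<Longrightarrow> outer_powers_associate S j"
    and v: "v \<in> products S (Suc n)"
  obtains w t j where "w \<in> products S n" "t \<in> S" "v = w \<otimes> t \<up> j"
proof -
  have "\<exists>w t j. w \<in> products S n \<and> t \<in> S \<and> v = w \<otimes> t \<up> j"
    using outer v
  proof (induction n arbitrary: v)
    case 0
    then obtain s i where "s \<in> S" "v = s \<up> i \<otimes> \<one>"
      by (metis products_SucE products.simps(1) singletonD)
    then have "v = \<one> \<otimes> s \<up> i" using S by auto
    then show ?case using \<open>s \<in> S\<close> by auto
  next
    case (Suc n)
    then obtain s i u where u: "v = s \<up> i \<otimes> u" "s \<in> S" "u \<in> products S (Suc n)"
      by (metis products_SucE)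
    moreover obtain w t j where w: "w \<in> products S n" "t \<in> S" "u = w \<otimes> t \<up> j"
      using Suc u(3) by (metis less_Suc_eq)
    moreover have "associates (s \<up> i) w (t \<up> j)"
      using Suc.prems(1)[of n] u w by (auto simp: outer_powers_associate_def)
    ultimately have "v = (s \<up> i \<otimes> w) \<otimes> t \<up> j" by (simp add: associates_def)
    then show ?case using products_SucI[OF u(2) w(1)] w(2) by metis
  qed
  then show ?thesis using that by blast
qed

text \<open>
  Consider \<open>(s\<^sup>i, v, t\<^sup>j)\<close> where \<open>v = r\<^sup>k \<otimes> w\<close>. If \<open>r = s\<close>, the first syllable of \<open>v\<close> merges with \<open>s\<^sup>i\<close>.
  If \<open>r = t\<close>, the pentagon for \<open>s\<^sup>i, t\<^sup>k, w, t\<^sup>j\<close> reduces the claim to \<open>(s\<^sup>i, t\<^sup>k, w \<otimes> t\<^sup>j)\<close>. Here a leading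
  power of \<open>s\<close> in \<open>w\<close> can be stripped by \<open>associates_power_left\<close>, and a leading power of \<open>t\<close> merges with
  \<open>t\<^sup>k\<close>, so that \<open>v\<close> is a shorter product.
\<close>

lemma outer_powers_associate_step:
  assumes S: "S \<subseteq> carrier Q" and two: "S \<subseteq> {a, b}"
    and outer: "\<And>j. j < Suc m \<Longrightarrow> outer_powers_associate S j"
    and initial: "\<And>j. j < Suc m \<Longrightarrow> initial_powers_associate S j"
  shows "outer_powers_associate S (Suc m)"
  unfolding outer_powers_associate_def
proof (intro ballI allI)
  fix s t v i j
  assume st: "s \<in> S" "t \<in> S" and v: "v \<in> products S (Suc m)"
  have out: "associates (s \<up> i) w (t \<up> j)" if "w \<in> products S k" "k < Suc m" "s \<in> S" "t \<in> S" for w k s t i j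
    using outer[of k] that by (auto simp: outer_powers_associate_def)
  have ini: "associates (s \<up> i) (t \<up> j) w" if "w \<in> products S k" "k < Suc m" "s \<in> S" "t \<in> S" for w k s t i j
    using initial[of k] that by (auto simp: initial_powers_associate_def)
  have car [simp]: "s \<in> carrier Q" if "s \<in> S" for s using that S by blast
  note carp = products_closed[OF S]
  obtain r k w where r: "v = r \<up> k \<otimes> w" "r \<in> S" "w \<in> products S m"
    using v by (rule products_SucE)
  have [simp]: "w \<in> carrier Q" "v \<in> carrier Q" using r v carp by blast+
  show "associates (s \<up> i) v (t \<up> j)"
  proof (cases "s = t")
    case True
    then show ?thesis using st by simp
  next
    case False
    then consider "r = s" | "r = t" using two st r by blast
    then show ?thesis
    proof cases
      case 1
      then show ?thesis
        using out[OF r(3) _ st, of k j] out[OF r(3) _ st, of "i + k" j] st r by (simp add: associates_def)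
    next
      case 2
      \<comment> \<open>Either the triple left by the pentagon associates, or two powers of \<open>t\<close> merge in \<open>v\<close>.\<close>
      have "associates (s \<up> i) (t \<up> k) (w \<otimes> t \<up> j) \<or> associates (s \<up> i) v (t \<up> j)"
      proof (cases m)
        case 0
        then show ?thesis using st r by simp
      next
        case (Suc n)
        then obtain q l u where u: "w = q \<up> l \<otimes> u" "q \<in> S" "u \<in> products S n"
          using r by (metis products_SucE)
        have [simp]: "u \<in> carrier Q" using u carp by blast
        show ?thesis
        proof (cases "q = s")
          case True
          have "w \<otimes> t \<up> j = s \<up> l \<otimes> (u \<otimes> t \<up> j)"
            using out[OF u(3) _ st, of l j] Suc u True by (simp add: associates_def)
          moreover have "u \<otimes> t \<up> j \<in> products S m"
            using products_mult_power[OF S _ st(2) u(3)] outer Suc by simp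
          then have "associates (s \<up> i) (t \<up> k) (s \<up> l \<otimes> (u \<otimes> t \<up> j))"
            using ini st by (intro associates_power_left) auto
          ultimately show ?thesis by simp
        next
          case q: False
          then have "q = t" using two u(2) st False by blast
          then have "v = t \<up> (k + l) \<otimes> u" using r 2 u st by simp
          then have "v \<in> products S m" using products_SucI st u Suc by simp
          then show ?thesis using out st by blast
        qed
      qed
      moreover have "associates (s \<up> i) v (t \<up> j)" if "associates (s \<up> i) (t \<up> k) (w \<otimes> t \<up> j)"
        unfolding r(1) 2 using that
      proof (rule associates_pentagon[rotated -1])
        show "associates (s \<up> i \<otimes> t \<up> k) w (t \<up> j)"
          using out[OF r(3) _ st] st by (intro associates_power_right) auto
        show "associates (s \<up> i) (t \<up> k) w" using ini[OF r(3) _ st] by simp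
      qed (use st in auto)
      ultimately show ?thesis by blast
    qed
  qed
qed

text \<open>
  Consider \<open>(s\<^sup>i, t\<^sup>j, v)\<close>. A leading power of \<open>s\<close> in \<open>v\<close> is stripped by \<open>associates_power_left\<close>. If \<open>v\<close>
  starts with a power of \<open>t\<close>, split off the last syllable instead, \<open>v = V \<otimes> q\<^sup>f\<close>, and put
  \<open>u = s\<^sup>i \<otimes> t\<^sup>j\<close>. Then it has to be seen that \<open>(u, V, q\<^sup>f)\<close> associates. For \<open>q = t\<close> the power \<open>t\<^sup>j\<close> of \<open>u\<close>
  is absorbed. For \<open>q = s\<close> one passes to the inverse \<open>u\<^sup>- = t\<^bsup>-j\<^esup> \<otimes> s\<^bsup>-i\<^esup>\<close>, which ends in a power of \<open>s\<close>,
  and to \<open>P = u \<otimes> V\<close>: since the two powers of \<open>t\<close> in \<open>P\<close> merge, \<open>P\<close> is no longer than \<open>v\<close>.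
\<close>

lemma initial_powers_associate_step:
  assumes S: "S \<subseteq> carrier Q" and two: "S \<subseteq> {a, b}"
    and outer: "\<And>j. j < Suc (Suc m) \<Longrightarrow> outer_powers_associate S j"
    and initial: "\<And>j. j < Suc m \<Longrightarrow> initial_powers_associate S j"
  shows "initial_powers_associate S (Suc m)"
  unfolding initial_powers_associate_def
proof (intro ballI allI)
  fix s t v i j
  assume st: "s \<in> S" "t \<in> S" and v: "v \<in> products S (Suc m)"
  have out: "associates (s \<up> i) w (t \<up> j)" if "w \<in> products S k" "k < Suc (Suc m)" "s \<in> S" "t \<in> S" for w k s t i j
    using outer[of k] that by (auto simp: outer_powers_associate_def)
  have ini: "associates (s \<up> i) (t \<up> j) w" if "w \<in> products S k" "k < Suc m" "s \<in> S" "t \<in> S" for w k s t i j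
    using initial[of k] that by (auto simp: initial_powers_associate_def)
  have car [simp]: "s \<in> carrier Q" if "s \<in> S" for s using that S by blast
  note carp = products_closed[OF S]
  obtain r k w where r: "v = r \<up> k \<otimes> w" "r \<in> S" "w \<in> products S m"
    using v by (rule products_SucE)
  have [simp]: "w \<in> carrier Q" "v \<in> carrier Q" using r v carp by blast+
  show "associates (s \<up> i) (t \<up> j) v"
  proof (cases "s = t \<or> m = 0 \<and> r = t")
    case True
    then show ?thesis using st r by auto
  next
    case False
    then consider "r = s" | n where "r = t" "m = Suc n" "s \<noteq> t" using two st r by (cases m) blast+
    then show ?thesis
    proof cases
      case 1
      then show ?thesis
        using ini[OF r(3) _ st] st r by (auto intro!: associates_power_left)
    next
      case 2
      obtain w' q f where w': "w' \<in> products S n" "q \<in> S" "w = w' \<otimes> q \<up> f"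
        using products_last_power[OF S _ r(3)[unfolded 2]] outer 2 by (metis less_SucI)
      have [simp]: "w' \<in> carrier Q" using w' carp by blast
      define V where "V = t \<up> k \<otimes> w'"
      have V: "V \<in> products S m" using products_SucI st w' 2 by (simp add: V_def)
      have [simp]: "V \<in> carrier Q" using V carp by blast
      have tV: "t \<up> j \<otimes> V \<in> products S m"
        using products_SucI[OF st(2) w'(1), of "j + k"] st 2 by (simp add: V_def)
      have [simp]: "t \<up> j \<otimes> V \<in> carrier Q" using tV carp by blast
      have v_eq: "v = V \<otimes> q \<up> f"
        using out[OF w'(1) _ st(2) w'(2), of k f] r 2 w' by (simp add: V_def associates_def)
      have uV: "(s \<up> i \<otimes> t \<up> j) \<otimes> V = s \<up> i \<otimes> (t \<up> j \<otimes> V)"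
        using ini[OF V _ st, of i j] by (simp add: associates_def)
      have "(s \<up> i \<otimes> t \<up> j) \<otimes> (V \<otimes> q \<up> f) = ((s \<up> i \<otimes> t \<up> j) \<otimes> V) \<otimes> q \<up> f"
      proof (cases "q = t")
        case True
        have "associates (s \<up> i \<otimes> t \<up> j) V (t \<up> f)"
          using out[OF V _ st] st by (intro associates_power_right) auto
        then show ?thesis using True by (simp add: associates_def)
      next
        case q: False
        then have q: "q = s" using two st w' 2 by blast
        let ?P = "s \<up> i \<otimes> (t \<up> j \<otimes> V)"
        have P: "?P \<in> products S (Suc m)" using products_SucI[OF st(1) tV] .
        have "associates (t \<up> (- j) \<otimes> s \<up> (- i)) ?P (s \<up> f)"
          using out[OF P _ st(2) st(1)] st by (intro associates_power_right) auto
        then have "(s \<up> i \<otimes> t \<up> j) \<otimes> (((s \<up> i \<otimes> t \<up> j)\<^sup>- \<otimes> ?P) \<otimes> s \<up> f) = ?P \<otimes> s \<up> f"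
          using st mult_inverse_left_cancel[of "s \<up> i \<otimes> t \<up> j" "?P \<otimes> s \<up> f"]
          by (simp add: associates_def)
        moreover have "(s \<up> i \<otimes> t \<up> j)\<^sup>- \<otimes> ?P = V"
          using inverse_left_cancel[of "s \<up> i \<otimes> t \<up> j" V] st by (simp only: uV) simp
        ultimately show ?thesis using q by (simp only: uV)
      qed
      also have "\<dots> = s \<up> i \<otimes> ((t \<up> j \<otimes> V) \<otimes> q \<up> f)"
        using out[OF tV _ st(1) w'(2), of i f] by (simp add: uV associates_def)
      also have "(t \<up> j \<otimes> V) \<otimes> q \<up> f = t \<up> j \<otimes> (V \<otimes> q \<up> f)"
        using out[OF V _ st(2) w'(2), of j f] by (simp add: associates_def)
      finally show ?thesis by (simp add: v_eq associates_def)
    qed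
  qed
qed

lemma powers_associate:
  assumes S: "S \<subseteq> carrier Q" and two: "S \<subseteq> {a, b}"
  shows "outer_powers_associate S n \<and> initial_powers_associate S n"
proof (induction n rule: less_induct)
  case (less n)
  show ?case
  proof (cases n)
    case 0
    then show ?thesis
      using S by (auto simp: outer_powers_associate_def initial_powers_associate_def subset_iff)
  next
    case (Suc m)
    have outer: "outer_powers_associate S n"
      using outer_powers_associate_step[OF S two] less Suc by blast
    moreover have "initial_powers_associate S n"
      using initial_powers_associate_step[OF S two, of m] less outer Suc by (metis less_Suc_eq)
    ultimately show ?thesis ..
  qed
qed


section \<open>The set of all products is a group\<close>

definition generated :: "'a set \<Rightarrow> 'a set" where
  "generated S = (\<Union>n. products S n)"

definition left_associator :: "'a set \<Rightarrow> 'a \<Rightarrow> bool" where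
  "left_associator S x \<longleftrightarrow> (\<forall>v\<in>generated S. \<forall>t\<in>S. \<forall>j. associates x v (t \<up> j))"

context
  fixes S a b
  assumes S: "S \<subseteq> carrier Q"
    and two: "S \<subseteq> {a, b}"
begin

lemma generator_closed [simp]: "s \<in> S \<Longrightarrow> s \<in> carrier Q"
  using S by blast

lemma generated_closed: "v \<in> generated S \<Longrightarrow> v \<in> carrier Q"
  using products_closed[OF S] by (auto simp: generated_def)

lemma one_generated: "\<one> \<in> generated S"
  unfolding generated_def using products.simps(1) by blast

lemma power_mult_generated: "\<lbrakk>s \<in> S; v \<in> generated S\<rbrakk> \<Longrightarrow> s \<up> i \<otimes> v \<in> generated S"
  unfolding generated_def using products_SucI by blast

lemma mult_power_generated: "\<lbrakk>v \<in> generated S; s \<in> S\<rbrakk> \<Longrightarrow> v \<otimes> s \<up> i \<in> generated S"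
  unfolding generated_def using products_mult_power[OF S] powers_associate[OF S two] by blast

lemma generated_induct [consumes 1, case_names one mult]:
  assumes "v \<in> generated S" and "P \<one>"
    and step: "\<And>v t j. \<lbrakk>v \<in> generated S; P v; t \<in> S\<rbrakk> \<Longrightarrow> P (v \<otimes> t \<up> j)"
  shows "P v"
proof -
  obtain n where "v \<in> products S n" using assms by (auto simp: generated_def)
  then show ?thesis
  proof (induction n arbitrary: v)
    case 0
    then show ?case using assms by simp
  next
    case (Suc n)
    then obtain w t j where "w \<in> products S n" "t \<in> S" "v = w \<otimes> t \<up> j"
      using products_last_power[OF S _ Suc.prems] powers_associate[OF S two] by metis
    moreover have "w \<in> generated S" using \<open>w \<in> products S n\<close> by (auto simp: generated_def)
    ultimately show ?case using Suc.IH step by blast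
  qed
qed

lemma inverse_generated: "v \<in> generated S \<Longrightarrow> v\<^sup>- \<in> generated S"
  by (induction rule: generated_induct)
     (simp_all add: one_generated generated_closed power_mult_generated)

lemma associates_outer_powers:
  "\<lbrakk>s \<in> S; t \<in> S; v \<in> generated S\<rbrakk> \<Longrightarrow> associates (s \<up> i) v (t \<up> j)"
  using powers_associate[OF S two] by (auto simp: generated_def outer_powers_associate_def)

lemma associates_final_powers:
  assumes "s \<in> S" "t \<in> S" "v \<in> generated S"
  shows "associates v (s \<up> i) (t \<up> j)"
proof -
  have "associates (t \<up> (- j)) (s \<up> (- i)) (v\<^sup>-)"
    using powers_associate[OF S two] inverse_generated[OF assms(3)] assms(1,2)
    by (auto simp: generated_def initial_powers_associate_def)
  then show ?thesis
    using associates_reverse[of v "s \<up> i" "t \<up> j"] assms generated_closed by simp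
qed

lemma left_associator_mult:
  assumes "left_associator S x" "x \<in> generated S" "v \<in> generated S"
  shows "x \<otimes> v \<in> generated S"
  using assms(3)
proof (induction rule: generated_induct)
  case one
  then show ?case using assms generated_closed by simp
next
  case (mult v t j)
  then have "x \<otimes> (v \<otimes> t \<up> j) = (x \<otimes> v) \<otimes> t \<up> j"
    using assms by (simp add: left_associator_def associates_def)
  then show ?case using mult mult_power_generated by simp
qed

text \<open>
  The step that reaches arbitrary products in the first entry. The triples \<open>(u, v, s\<^sup>j)\<close> come from
  absorbing \<open>s\<^sup>k\<close>. No power of \<open>t\<close> can be absorbed into \<open>u\<close>, but \<open>u\<close> is the product of
  \<open>y = x \<otimes> t\<^bsup>d-j\<^esup>\<close> and \<open>z = t\<^sup>j \<otimes> s\<^sup>k\<close>, whence \<open>(u, v, z)\<close> is a shift of \<open>(y, v, z)\<close>; splitting \<open>z\<close> gives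
  \<open>(u, v, t\<^sup>j)\<close>. The splitting needs \<open>u \<otimes> v\<close> to be a product of syllables again, which is established
  along with the claim by adding syllables to \<open>v\<close>.
\<close>

lemma left_associator_mult_power:
  assumes x: "x \<in> generated S" and st: "s \<in> S" "t \<in> S"
    and assoc: "\<And>d. left_associator S (x \<otimes> t \<up> d)"
  shows "left_associator S ((x \<otimes> t \<up> d) \<otimes> s \<up> k)"
proof (cases "s = t")
  case True
  then show ?thesis using assoc generated_closed[OF x] st by simp
next
  case False
  define u where "u = (x \<otimes> t \<up> d) \<otimes> s \<up> k"
  have xt: "x \<otimes> t \<up> i \<in> generated S" for i using x st(2) by (rule mult_power_generated)
  have u: "u \<in> generated S" unfolding u_def using xt st(1) by (rule mult_power_generated)
  have [simp]: "x \<in> carrier Q" "u \<in> carrier Q" "s \<in> carrier Q" "t \<in> carrier Q"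
    using x u st generated_closed generator_closed by blast+
  have assoc': "associates (x \<otimes> t \<up> i) v (r \<up> j)" if "v \<in> generated S" "r \<in> S" for i v r j
    using assoc that by (auto simp: left_associator_def)
  have s: "associates u v (s \<up> j)" if "v \<in> generated S" for v j
    unfolding u_def by (intro associates_power_right assoc') (use that st generated_closed in auto)
  have t: "associates u v (t \<up> j)" if v: "v \<in> generated S" and uv: "u \<otimes> v \<in> generated S" for v j
  proof -
    define z where "z = t \<up> j \<otimes> s \<up> k"
    define y where "y = x \<otimes> t \<up> (d - j)"
    have y: "y \<in> generated S" using xt by (simp add: y_def)
    have vt: "v \<otimes> t \<up> j \<in> generated S" using v st(2) by (rule mult_power_generated)
    have yv: "y \<otimes> v \<in> generated S"
      unfolding y_def using assoc xt v by (rule left_associator_mult)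
    have [simp]: "v \<in> carrier Q" "y \<in> carrier Q" "z \<in> carrier Q"
      using v y generated_closed by (simp_all add: z_def)
    have final: "(w \<otimes> t \<up> j) \<otimes> s \<up> k = w \<otimes> z" if "w \<in> generated S" for w
      using associates_final_powers[OF st(2,1) that] by (simp add: associates_def z_def)
    have yz: "y \<otimes> z = u"
      using final[OF y] by (simp add: u_def y_def)
    have "(y \<otimes> v) \<otimes> z = ((y \<otimes> v) \<otimes> t \<up> j) \<otimes> s \<up> k"
      by (simp only: final[OF yv])
    also have "\<dots> = y \<otimes> ((v \<otimes> t \<up> j) \<otimes> s \<up> k)"
      using assoc'[OF v st(2), of "d - j" j] assoc'[OF vt st(1), of "d - j" k]
      by (simp only: associates_def y_def)
    finally have "associates y v z"
      by (simp only: associates_def final[OF v])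
    then have "associates u v z"
      using associates_shift_left[of y v z] by (simp add: yz)
    then have "((u \<otimes> v) \<otimes> t \<up> j) \<otimes> s \<up> k = u \<otimes> ((v \<otimes> t \<up> j) \<otimes> s \<up> k)"
      by (simp only: associates_def final[OF uv] final[OF v])
    also have "\<dots> = (u \<otimes> (v \<otimes> t \<up> j)) \<otimes> s \<up> k"
      using s[OF vt, of k] by (simp only: associates_def)
    finally show ?thesis by (simp add: associates_def right_cancel)
  qed
  have both: "associates u v (r \<up> j)" if "v \<in> generated S" "u \<otimes> v \<in> generated S" "r \<in> S" for v r j
  proof -
    have "r = s \<or> r = t" using two st that(3) False by blast
    then show ?thesis using s t that(1,2) by blast
  qed
  have "u \<otimes> v \<in> generated S" if "v \<in> generated S" for v
    using that
  proof (induction rule: generated_induct)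
    case one
    then show ?case using u by simp
  next
    case (mult v r j)
    then have "u \<otimes> (v \<otimes> r \<up> j) = (u \<otimes> v) \<otimes> r \<up> j"
      using both[of v r j] by (simp only: associates_def)
    then show ?case using mult mult_power_generated[of "u \<otimes> v" r j] by simp
  qed
  then show ?thesis using both by (simp add: left_associator_def flip: u_def)
qed

text \<open>
  The induction runs over \<open>x\<close> and keeps all \<open>x \<otimes> t\<^sup>d\<close> in view for both generators \<open>t\<close>, as the previous
  lemma requires.
\<close>

lemma left_associator_generated:
  assumes "x \<in> generated S"
  shows "left_associator S x"
proof -
  have mult: "\<forall>t\<in>S. \<forall>d. left_associator S (x \<otimes> t \<up> d)" if "x \<in> generated S" for x
    using that
  proof (induction rule: generated_induct)
    case one
    then show ?case using associates_outer_powers by (simp add: left_associator_def)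
  next
    case (mult v t j)
    then show ?case using left_associator_mult_power by simp
  qed
  show ?thesis
    using assms
  proof (induction rule: generated_induct)
    case one
    then show ?case by (simp add: left_associator_def generated_closed)
  qed (use mult in blast)
qed

lemma generated_mult: "\<lbrakk>x \<in> generated S; y \<in> generated S\<rbrakk> \<Longrightarrow> x \<otimes> y \<in> generated S"
  using left_associator_mult left_associator_generated by blast

lemma generated_associates:
  assumes "x \<in> generated S" "y \<in> generated S" "z \<in> generated S"
  shows "associates x y z"
  using assms(3)
proof (induction rule: generated_induct)
  case one
  then show ?case using assms generated_closed by simp
next
  case (mult z t j)
  have *: "associates w v (t \<up> j)" if "w \<in> generated S" "v \<in> generated S" for v w
    using left_associator_generated that mult by (auto simp: left_associator_def)
  have "(x \<otimes> y) \<otimes> (z \<otimes> t \<up> j) = (x \<otimes> (y \<otimes> z)) \<otimes> t \<up> j"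
    using *[of "x \<otimes> y" z] mult assms by (simp add: associates_def generated_mult)
  also have "\<dots> = x \<otimes> (y \<otimes> (z \<otimes> t \<up> j))"
    using *[of x "y \<otimes> z"] *[of y z] mult assms by (simp add: associates_def generated_mult)
  finally show ?case by (simp add: associates_def)
qed

lemma subloop_generated_subset:
  assumes "T \<subseteq> S" "x \<in> subloop_generated Q T"
  shows "x \<in> generated S"
  using assms(2)
proof induction
  case (incl x)
  then have "x \<up> 1 \<otimes> \<one> \<in> generated S"
    using assms power_mult_generated one_generated by blast
  then show ?case using incl assms by (simp add: subset_iff)
qed (simp_all add: one_generated generated_mult ldiv_eq rdiv_eq generated_closed inverse_generated)

end

lemma group_subloop_generated_pair:
  assumes ab: "a \<in> carrier Q" "b \<in> carrier Q"
  shows "group (Q\<lparr>carrier := subloop_generated Q {a, b}\<rparr>)"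
proof -
  have S: "{a, b} \<subseteq> carrier Q" using ab by simp
  have gen: "x \<in> generated {a, b}" if "x \<in> subloop_generated Q {a, b}" for x
    using that by (rule subloop_generated_subset[OF S, rotated 2]) auto
  show ?thesis
  proof (rule groupI)
    fix x y z
    assume "x \<in> carrier (Q\<lparr>carrier := subloop_generated Q {a, b}\<rparr>)"
      "y \<in> carrier (Q\<lparr>carrier := subloop_generated Q {a, b}\<rparr>)"
      "z \<in> carrier (Q\<lparr>carrier := subloop_generated Q {a, b}\<rparr>)"
    then have "associates x y z"
      using generated_associates[OF S subset_refl] gen by simp
    then show "x \<otimes>\<^bsub>Q\<lparr>carrier := subloop_generated Q {a, b}\<rparr>\<^esub> y
        \<otimes>\<^bsub>Q\<lparr>carrier := subloop_generated Q {a, b}\<rparr>\<^esub> z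
        = x \<otimes>\<^bsub>Q\<lparr>carrier := subloop_generated Q {a, b}\<rparr>\<^esub>
          (y \<otimes>\<^bsub>Q\<lparr>carrier := subloop_generated Q {a, b}\<rparr>\<^esub> z)"
      by (simp add: associates_def)
  next
    fix x
    assume "x \<in> carrier (Q\<lparr>carrier := subloop_generated Q {a, b}\<rparr>)"
    then have "\<one> \<oslash> x \<in> subloop_generated Q {a, b}" "x \<in> carrier Q"
      using subloop_generated_closed[OF S] by (simp_all add: subloop_generated.intros)
    then show "\<exists>y\<in>carrier (Q\<lparr>carrier := subloop_generated Q {a, b}\<rparr>).
        y \<otimes>\<^bsub>Q\<lparr>carrier := subloop_generated Q {a, b}\<rparr>\<^esub> x
        = \<one>\<^bsub>Q\<lparr>carrier := subloop_generated Q {a, b}\<rparr>\<^esub>"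
      by (intro bexI[of _ "\<one> \<oslash> x"]) simp_all
  qed (simp_all add: subloop_generated.intros subloop_generated_closed[OF S])
qed


end

theorem theorem2p3:
  fixes Q :: "('a, 'b) loop_scheme"
  assumes "loop Q"
    and "semi_universally_flexible Q"
    and "inverse_property Q"
  shows "diassociative Q"
proof -
  interpret suf_ip_loop Q
    using assms by (simp add: suf_ip_loop_def suf_ip_loop_axioms_def)
  show ?thesis
    by (simp add: diassociative_def group_subloop_generated_pair)
qed

end
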